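(* The number of $1$-nice $n$-dimensional unique sink orientations is $n^{\Theta(2^n)}$.
   Context: Let $Q^n = 2^{[n]}$ be the vertex set of the $n$-cube, with $u,v$ adjacent iff $|u\oplus v|=1$; faces are $F_{J,v}=\{u : v\oplus u\subseteq J\}$ for $J\subseteq[n]$. A unique sink orientation (USO) is an orientation of the cube's edges such that every nonempty face has a unique sink (vertex with no outgoing edges within the face). The outmap $s_\psi(v)$ is the set of coordinates $j$ such that the edge $\{v,v\oplus\{j\}\}$ is directed away from $v$; the global sink is the vertex $t$ with $s_\psi(t)=\emptyset$. Let $d(v,u)$ be the length of a shortest directed path from $v$ to $u$ ($\infty$ if none). The reachmap is $r_\psi(v)=s_\psi(v)\cup\{j : \exists u \text{ reachable from } v \text{ by a directed path with } j\in s_\psi(u)\}$. A vertex $v$ is $i$-covered by $u$ if $d(v,u)\le i$ and $r_\psi(u)\subsetneq r_\psi(v)$; $\psi$ is $i$-nice if every vertex other than the global sink is $i$-covered by some vertex. *)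

theory Defs
  imports Complex_Main "HOL-Library.Extended_Nat"
begin

text \<open>Coordinates are 0,...,n-1 (so [n] is rendered as {0..<n}).
  Vertices of the n-cube are subsets of {0..<n}.  An orientation is represented
  by its outmap s (which determines the orientation and vice versa):
  j \<in> s v iff the edge {v, v \<oplus> {j}} is directed away from v.
  Outmaps are taken extensional (= {} outside the cube) so that the set of
  orientations is finite and its cardinality counts orientations.\<close>

definition symd :: "nat set \<Rightarrow> nat set \<Rightarrow> nat set" where
  "symd A B = (A - B) \<union> (B - A)"

definition cube :: "nat \<Rightarrow> nat set set" where
  "cube n = Pow {0..<n}"

definition orientation :: "nat \<Rightarrow> (nat set \<Rightarrow> nat set) \<Rightarrow> bool" where
  "orientation n s \<longleftrightarrow>
     (\<forall>v. v \<notin> cube n \<longrightarrow> s v = {}) \<and>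
     (\<forall>v \<in> cube n. s v \<subseteq> {0..<n} \<and>
        (\<forall>j < n. j \<in> s v \<longleftrightarrow> j \<notin> s (symd v {j})))"

definition face :: "nat \<Rightarrow> nat set \<Rightarrow> nat set \<Rightarrow> nat set set" where
  "face n J v = {u \<in> cube n. symd v u \<subseteq> J}"

definition is_USO :: "nat \<Rightarrow> (nat set \<Rightarrow> nat set) \<Rightarrow> bool" where
  "is_USO n s \<longleftrightarrow> orientation n s \<and>
     (\<forall>J. J \<subseteq> {0..<n} \<longrightarrow> (\<forall>v \<in> cube n. \<exists>!u. u \<in> face n J v \<and> s u \<inter> J = {}))"

definition global_sink :: "nat \<Rightarrow> (nat set \<Rightarrow> nat set) \<Rightarrow> nat set" where
  "global_sink n s = (THE t. t \<in> cube n \<and> s t = {})"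

definition arcs :: "nat \<Rightarrow> (nat set \<Rightarrow> nat set) \<Rightarrow> (nat set \<times> nat set) set" where
  "arcs n s = {(v, symd v {j}) | v j. v \<in> cube n \<and> j < n \<and> j \<in> s v}"

text \<open>Length of a shortest directed path (\<infinity> if none).\<close>
definition dpath :: "nat \<Rightarrow> (nat set \<Rightarrow> nat set) \<Rightarrow> nat set \<Rightarrow> nat set \<Rightarrow> enat" where
  "dpath n s v u = Inf {enat k | k. (v, u) \<in> (arcs n s) ^^ k}"

definition reachmap :: "nat \<Rightarrow> (nat set \<Rightarrow> nat set) \<Rightarrow> nat set \<Rightarrow> nat set" where
  "reachmap n s v = s v \<union> {j. \<exists>u. (v, u) \<in> (arcs n s)\<^sup>* \<and> j \<in> s u}"

definition covered_by :: "nat \<Rightarrow> (nat set \<Rightarrow> nat set) \<Rightarrow> nat \<Rightarrow> nat set \<Rightarrow> nat set \<Rightarrow> bool" where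
  "covered_by n s i v u \<longleftrightarrow> dpath n s v u \<le> enat i \<and> reachmap n s u \<subset> reachmap n s v"

definition nice :: "nat \<Rightarrow> nat \<Rightarrow> (nat set \<Rightarrow> nat set) \<Rightarrow> bool" where
  "nice n i s \<longleftrightarrow>
     (\<forall>v \<in> cube n. v \<noteq> global_sink n s \<longrightarrow> (\<exists>u \<in> cube n. covered_by n s i v u))"

end

theory Submission
  imports Defs
begin

text \<open>Upper bound: reveal the downward edges of the vertices level by level. In the 2-face below
  \<open>w\<close> in directions \<open>a\<close>, \<open>b\<close>, the outmap of the bottom vertex is already known, and USOs forbid
  \<open>w\<close> to have the same pattern on \<open>a\<close>, \<open>b\<close>. Hence the possible downward outmaps of \<open>w\<close> shatter
  no pair of directions, and by the Sauer-Shelah bound there are at most \<open>card w + 1\<close> of them.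

  Lower bound: flipping any matching in the uniform orientation (all edges directed towards the
  empty set) yields a USO. If only edges of the upper facet in the last direction are
  flipped, the orientation is 1-nice: a vertex of the upper facet is covered by its neighbour in the
  lower facet, where the orientation is still uniform. Choosing edges greedily shows that
  a facet has sufficiently many matchings.\<close>

section \<open>Upper bound\<close>

text \<open>Deleting \<open>x\<close> from all members leaves the traces
  \<open>F0 \<union> F1\<close>, to which induction applies. What is lost is counted by
  \<open>F0 \<inter> F1\<close>, the sets that occur in \<open>F\<close> both with and without
  \<open>x\<close>. If two of these differed at some \<open>b\<close>, all four patterns on
  \<open>{x, b}\<close> would occur, so there is at most one.\<close>

lemma card_le_of_pair_traces:
  fixes F :: "'a set set"
  assumes "finite U" and "F \<subseteq> Pow U"
    and "\<And>a b. a \<in> U \<Longrightarrow> b \<in> U \<Longrightarrow> a \<noteq> b \<Longrightarrow> \<exists>P. \<forall>A\<in>F. A \<inter> {a, b} \<noteq> P \<inter> {a, b}"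
  shows "card F \<le> card U + 1"
  using assms
proof (induction U arbitrary: F rule: finite_induct)
  case empty
  then have "F \<subseteq> {{}}" by auto
  then have "card F \<le> card {{} :: 'a set}" by (intro card_mono) auto
  then show ?case by simp
next
  case (insert x U)
  define F0 where "F0 = {A \<in> F. x \<notin> A}"
  define F1 where "F1 = (\<lambda>A. A - {x}) ` {A \<in> F. x \<in> A}"
  have finF: "finite F"
    using insert.prems(1) insert.hyps(1) by (meson finite_Pow_iff finite_insert finite_subset)
  have inj: "inj_on (\<lambda>A. A - {x}) {A \<in> F. x \<in> A}"
    by (intro inj_onI) (metis (no_types, lifting) insert_Diff mem_Collect_eq)
  have "card F = card F0 + card {A \<in> F. x \<in> A}"
  proof -
    have "F = F0 \<union> {A \<in> F. x \<in> A}" by (auto simp: F0_def)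
    moreover have "F0 \<inter> {A \<in> F. x \<in> A} = {}" by (auto simp: F0_def)
    ultimately show ?thesis
      using finF by (metis card_Un_disjoint finite_Un)
  qed
  also have "\<dots> = card F0 + card F1"
    using card_image[OF inj] by (simp add: F1_def)
  also have "\<dots> = card (F0 \<union> F1) + card (F0 \<inter> F1)"
    using finF by (intro card_Un_Int) (auto simp: F0_def F1_def)
  also have "card (F0 \<union> F1) \<le> card U + 1"
  proof (rule insert.IH)
    show "F0 \<union> F1 \<subseteq> Pow U"
      using insert.prems(1) by (auto simp: F0_def F1_def)
    fix a b assume ab: "a \<in> U" "b \<in> U" "a \<noteq> b"
    then obtain P where P: "\<And>A. A \<in> F \<Longrightarrow> A \<inter> {a, b} \<noteq> P \<inter> {a, b}"
      using insert.prems(2)[of a b] by blast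
    have "(A - {x}) \<inter> {a, b} = A \<inter> {a, b}" for A
      using ab insert.hyps(2) by auto
    then have "\<forall>A\<in>F0 \<union> F1. A \<inter> {a, b} \<noteq> P \<inter> {a, b}"
      using P by (auto simp: F0_def F1_def simp del: Int_insert_right)
    then show "\<exists>P. \<forall>A\<in>F0 \<union> F1. A \<inter> {a, b} \<noteq> P \<inter> {a, b}" by blast
  qed
  also have "card (F0 \<inter> F1) \<le> 1"
  proof -
    have "A = B" if A: "A \<in> F0 \<inter> F1" and B: "B \<in> F0 \<inter> F1" for A B
    proof (rule ccontr)
      assume "A \<noteq> B"
      then obtain A B b where AB: "A \<in> F0 \<inter> F1" "B \<in> F0 \<inter> F1" and b: "b \<in> A" "b \<notin> B"
        using A B by blast
      have fourth: "A \<in> F" "B \<in> F" "insert x A \<in> F" "insert x B \<in> F" "x \<notin> A" "x \<notin> B"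
        using AB by (auto simp: F0_def F1_def insert_absorb)
      have "b \<in> U" using b fourth insert.prems(1) by auto
      then obtain P where P: "\<And>A. A \<in> F \<Longrightarrow> A \<inter> {x, b} \<noteq> P \<inter> {x, b}"
        using insert.prems(2)[of x b] insert.hyps(2) by blast
      have "x \<noteq> b" using \<open>b \<in> U\<close> insert.hyps(2) by auto
      then show False
        using P[OF fourth(1)] P[OF fourth(2)] P[OF fourth(3)] P[OF fourth(4)] fourth(5,6) b
        by (cases "x \<in> P"; cases "b \<in> P") auto
    qed
    then show ?thesis
      using finF by (intro card_le_Suc0_iff_eq[THEN iffD2, simplified One_nat_def[symmetric]])
        (auto simp: F0_def)
  qed
  finally show ?case using insert.hyps by simp
qed

lemma card_le_fibres:
  assumes "finite A" and "\<And>y. y \<in> f ` A \<Longrightarrow> card {x \<in> A. f x = y} \<le> k"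
  shows "card A \<le> k * card (f ` A)"
proof -
  have "card A = card (\<Union>y\<in>f ` A. {x \<in> A. f x = y})"
    by (rule arg_cong[where f = card]) auto
  also have "\<dots> \<le> (\<Sum>y\<in>f ` A. card {x \<in> A. f x = y})"
    using assms(1) by (intro card_UN_le) auto
  also have "\<dots> \<le> (\<Sum>y\<in>f ` A. k)"
    by (intro sum_mono assms(2))
  finally show ?thesis by (simp add: mult.commute)
qed

section \<open>Two-dimensional faces of a USO\<close>

lemma orientation_insert_iff:
  assumes "orientation n s" "insert j v \<in> cube n" "j \<notin> v"
  shows "j \<in> s v \<longleftrightarrow> j \<notin> s (insert j v)"
proof -
  have "v \<in> cube n" "j < n" using assms(2) by (auto simp: cube_def)
  moreover have "symd v {j} = insert j v" using assms(3) by (auto simp: symd_def)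
  ultimately show ?thesis using assms(1) unfolding orientation_def by metis
qed

lemma USO_unique_sink:
  assumes "is_USO n s" "J \<subseteq> {0..<n}" "v \<in> cube n"
  shows "\<exists>!u. u \<in> face n J v \<and> s u \<inter> J = {}"
  using assms by (simp add: is_USO_def)

text \<open>The outmaps of antipodal vertices of a 2-face must differ inside the face: otherwise the face
  has two sinks or is a directed cycle.\<close>

lemma USO_antipodal_2face:
  assumes uso: "is_USO n s" and w: "insert a (insert b y) \<in> cube n"
    and y: "a \<notin> y" "b \<notin> y" "a \<noteq> b"
  shows "s (insert a (insert b y)) \<inter> {a, b} \<noteq> s y \<inter> {a, b}"
proof
  let ?w = "insert a (insert b y)"
  assume eq: "s ?w \<inter> {a, b} = s y \<inter> {a, b}"
  have ori: "orientation n s" using uso by (simp add: is_USO_def)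
  have cubes: "y \<in> cube n" "insert a y \<in> cube n" "insert b y \<in> cube n" "?w \<in> cube n"
    using w by (auto simp: cube_def)
  have e1: "a \<in> s y \<longleftrightarrow> a \<notin> s (insert a y)"
    using orientation_insert_iff[OF ori cubes(2)] y by blast
  have e2: "b \<in> s y \<longleftrightarrow> b \<notin> s (insert b y)"
    using orientation_insert_iff[OF ori cubes(3)] y by blast
  have e3: "a \<in> s (insert b y) \<longleftrightarrow> a \<notin> s ?w"
    using orientation_insert_iff[OF ori cubes(4)] y by blast
  have e4: "b \<in> s (insert a y) \<longleftrightarrow> b \<notin> s ?w"
    using orientation_insert_iff[OF ori, of b "insert a y"] cubes(4) y
    by (auto simp: insert_commute)
  have "{a, b} \<subseteq> {0..<n}" using w by (auto simp: cube_def)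
  from USO_unique_sink[OF uso this cubes(1)]
  obtain u where u: "u \<in> face n {a, b} y \<and> s u \<inter> {a, b} = {}"
    and uniq: "\<forall>u'. u' \<in> face n {a, b} y \<and> s u' \<inter> {a, b} = {} \<longrightarrow> u' = u"
    by (rule ex1E)
  have faces: "y \<in> face n {a, b} y" "insert a y \<in> face n {a, b} y"
      "insert b y \<in> face n {a, b} y" "?w \<in> face n {a, b} y"
    using cubes by (auto simp: face_def symd_def)
  have "u = y \<or> u = insert a y \<or> u = insert b y \<or> u = ?w"
  proof -
    have "u - {a, b} = y - {a, b}" using u by (auto simp: face_def symd_def)
    then show ?thesis using y by (cases "a \<in> u"; cases "b \<in> u") blast+
  qed
  moreover have ne: "y \<noteq> ?w" "insert a y \<noteq> insert b y" using y by auto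
  moreover have "u \<noteq> y" "u \<noteq> ?w"
    using u uniq faces(1,4) eq ne(1) by metis+
  moreover have sinks: "c \<notin> s u" if "c = a \<or> c = b" for c using u that by blast
  moreover have "a \<in> s y \<longleftrightarrow> a \<in> s ?w" "b \<in> s y \<longleftrightarrow> b \<in> s ?w" using eq by blast+
  moreover have "u' = u" if "a \<notin> s u'" "b \<notin> s u'" "u' \<in> face n {a, b} y" for u'
    using uniq that by blast
  \<comment> \<open>If \<open>insert a y\<close> is the sink, the edge relations make
    \<open>a\<close> and \<open>b\<close> outgoing at \<open>?w\<close> or \<open>y\<close>, hence
    at both by \<open>eq\<close>; then \<open>insert b y\<close> is a second sink. The other case is
    symmetric.\<close>
  ultimately show False
    using e1 e2 e3 e4 faces(2,3) by metis
qed

section \<open>Counting USOs by their downward edges\<close>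

lemma finite_cube: "finite (cube n)"
  by (simp add: cube_def)

lemma finite_USO: "finite {s. is_USO n s}"
proof -
  have "finite {s. \<forall>v. (v \<in> cube n \<longrightarrow> s v \<in> Pow {0..<n}) \<and> (v \<notin> cube n \<longrightarrow> s v = {})}"
    by (rule finite_set_of_finite_funs) (simp_all add: cube_def)
  then show ?thesis
    by (rule finite_subset[rotated]) (auto simp: is_USO_def orientation_def)
qed

text \<open>Each edge is recorded only at its upper end. The default outside \<open>V\<close> makes
  restriction to a smaller vertex set a map between the images of \<open>down_out\<close>.\<close>

definition down_out :: "nat set set \<Rightarrow> (nat set \<Rightarrow> nat set) \<Rightarrow> nat set \<Rightarrow> nat set" where
  "down_out V s = (\<lambda>w. if w \<in> V then s w \<inter> w else {})"

text \<open>Induction on a down-closed set: removing a vertex \<open>w\<close> of maximal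
  cardinality keeps it down-closed. Each record on the remaining vertices extends to
  \<open>w\<close> in at most \<open>card w + 1\<close> ways, since the possible values at
  \<open>w\<close> shatter no pair.\<close>

lemma card_down_out_le:
  assumes "V \<subseteq> cube n" and "\<And>w u. w \<in> V \<Longrightarrow> u \<subseteq> w \<Longrightarrow> u \<in> V"
  shows "card (down_out V ` {s. is_USO n s}) \<le> (n + 1) ^ card V"
  using assms
proof (induction "card V" arbitrary: V)
  case 0
  then have "V = {}" using finite_subset[OF _ finite_cube] by fastforce
  then have "down_out V ` {s. is_USO n s} \<subseteq> {\<lambda>_. {}}" by (auto simp: down_out_def)
  then have "card (down_out V ` {s. is_USO n s}) \<le> card {\<lambda>_ :: nat set. {} :: nat set}"
    by (intro card_mono) auto
  then show ?case using 0 by simp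
next
  case (Suc k)
  have finV: "finite V" using Suc.prems(1) finite_cube finite_subset by blast
  moreover have "V \<noteq> {}" using Suc.hyps(2) by auto
  ultimately have "Max (card ` V) \<in> card ` V" by (intro Max_in) auto
  then obtain w where w: "w \<in> V" "card w = Max (card ` V)" by force
  have wmax: "card u \<le> card w" if "u \<in> V" for u using w finV that by simp
  define V' where "V' = V - {w}"
  have wn: "w \<subseteq> {0..<n}" using w Suc.prems(1) by (auto simp: cube_def)
  have finw: "finite w" using wn finite_subset by blast
  have down': "u \<in> V'" if "v \<in> V'" "u \<subseteq> v" for u v
  proof -
    have v: "v \<in> V" "v \<noteq> w" using that by (auto simp: V'_def)
    have "u \<in> V" using Suc.prems(2) that v by blast
    moreover have "u \<noteq> w"
    proof
      assume "u = w"
      then have "w \<subset> v" using that v by blast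
      moreover have "finite v" using v(1) Suc.prems(1) by (auto simp: cube_def intro: finite_subset)
      ultimately have "card w < card v" by (rule psubset_card_mono[rotated])
      then show False using wmax[OF v(1)] by simp
    qed
    ultimately show ?thesis by (simp add: V'_def)
  qed
  have cV': "card V' = k" "V' \<subseteq> cube n" using Suc.hyps(2) w finV Suc.prems(1) by (auto simp: V'_def)
  let ?F = "down_out V ` {s. is_USO n s}"
  let ?r = "\<lambda>f u. if u \<in> V' then f u else ({} :: nat set)"
  have img: "?r ` ?F = down_out V' ` {s. is_USO n s}"
  proof -
    have "?r (down_out V s) = down_out V' s" for s
      by (rule ext) (auto simp: down_out_def V'_def)
    then show ?thesis by (simp add: image_image)
  qed
  have "card ?F \<le> (n + 1) * card (?r ` ?F)"
  proof (rule card_le_fibres)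
    show "finite ?F" using finite_USO by simp
    fix g assume "g \<in> ?r ` ?F"
    define Fib where "Fib = {f \<in> ?F. ?r f = g}"
    have Fib: "\<exists>s. is_USO n s \<and> f = down_out V s" "\<And>u. u \<in> V' \<Longrightarrow> f u = g u"
      if "f \<in> Fib" for f
    proof -
      show "\<exists>s. is_USO n s \<and> f = down_out V s" using that unfolding Fib_def by blast
      have g: "?r f = g" using that by (simp add: Fib_def)
      show "f u = g u" if "u \<in> V'" for u using fun_cong[OF g, of u] that by simp
    qed
    \<comment> \<open>Members of the fibre agree with \<open>g\<close> on \<open>V'\<close> and are
      empty outside \<open>V\<close>, so only the value at \<open>w\<close> is free.\<close>
    have inj: "inj_on (\<lambda>f. f w) Fib"
    proof (rule inj_onI)
      fix f f' assume f: "f \<in> Fib" "f' \<in> Fib" "f w = f' w"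
      have "f u = {}" "f' u = {}" if "u \<notin> V" for u
        using Fib(1)[OF f(1)] Fib(1)[OF f(2)] that by (auto simp: down_out_def)
      then have "f u = f' u" for u
        using Fib(2)[OF f(1)] Fib(2)[OF f(2)] f(3) by (cases "u \<in> V"; cases "u = w") (auto simp: V'_def)
      then show "f = f'" by (rule ext)
    qed
    have "card ((\<lambda>f. f w) ` Fib) \<le> card w + 1"
    proof (rule card_le_of_pair_traces[OF finw])
      have "f w \<subseteq> w" if "f \<in> Fib" for f
        using Fib(1)[OF that] w(1) by (auto simp: down_out_def)
      then show "(\<lambda>f. f w) ` Fib \<subseteq> Pow w" by blast
      fix a b assume ab: "a \<in> w" "b \<in> w" "a \<noteq> b"
      define y where "y = w - {a, b}"
      have weq: "insert a (insert b y) = w" and y: "a \<notin> y" "b \<notin> y"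
        using ab by (auto simp: y_def)
      have V: "insert a y \<in> V'" "insert b y \<in> V'"
      proof -
        have "b \<notin> insert a y" "a \<notin> insert b y" using y ab(3) by auto
        then have "insert a y \<noteq> w" "insert b y \<noteq> w" using ab by blast+
        moreover have "insert a y \<subseteq> w" "insert b y \<subseteq> w" using weq by blast+
        ultimately show "insert a y \<in> V'" "insert b y \<in> V'"
          using Suc.prems(2)[OF w(1)] by (simp_all add: V'_def)
      qed
      have wc: "w \<in> cube n" using wn by (simp add: cube_def)
      \<comment> \<open>On \<open>{a, b}\<close> this is the outmap of the bottom vertex
        \<open>y\<close>, read off from \<open>g\<close>: the edge between \<open>y\<close> and
        \<open>insert c y\<close> is a downward edge of \<open>insert c y\<close>, which lies in
        \<open>V'\<close>. The pattern is thus common to the whole fibre, and it is the one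
        forbidden at \<open>w\<close>.\<close>
      define P where "P = {c. c \<notin> g (insert c y)}"
      have "f w \<inter> {a, b} \<noteq> P \<inter> {a, b}" if fib: "f \<in> Fib" for f
      proof -
        obtain s where s: "is_USO n s" and f: "f = down_out V s"
          using Fib(1)[OF fib] by blast
        have ori: "orientation n s" using s by (simp add: is_USO_def)
        have "c \<in> s y \<longleftrightarrow> c \<in> P" if c: "c \<in> {a, b}" for c
        proof -
          have cV: "insert c y \<in> V'" "c \<notin> y" using c V y by auto
          then have "g (insert c y) = s (insert c y) \<inter> insert c y"
            using Fib(2)[OF fib cV(1)] f by (simp add: down_out_def V'_def)
          moreover have "c \<in> s y \<longleftrightarrow> c \<notin> s (insert c y)"
            using orientation_insert_iff[OF ori] cV cV'(2) by blast
          ultimately show ?thesis by (simp add: P_def)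
        qed
        then have "s y \<inter> {a, b} = P \<inter> {a, b}" by blast
        moreover have "s w \<inter> {a, b} \<noteq> s y \<inter> {a, b}"
          using USO_antipodal_2face[OF s, of a b y] weq wc y ab by simp
        moreover have "f w \<inter> {a, b} = s w \<inter> {a, b}"
          using f w ab by (auto simp: down_out_def)
        ultimately show ?thesis by simp
      qed
      then show "\<exists>P. \<forall>A\<in>(\<lambda>f. f w) ` Fib. A \<inter> {a, b} \<noteq> P \<inter> {a, b}" by blast
    qed
    also have "card w \<le> n" using card_mono[OF _ wn] by simp
    finally show "card {f \<in> ?F. ?r f = g} \<le> n + 1"
      using card_image[OF inj] by (simp add: Fib_def)
  qed
  also have "\<dots> \<le> (n + 1) * (n + 1) ^ card V'"
    unfolding img using Suc.hyps(1)[of V'] cV' down' by (intro mult_left_mono) auto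
  finally show ?case using cV' Suc.hyps(2)[symmetric] by simp
qed

text \<open>With \<open>V\<close> the whole cube, every edge is a downward edge of its upper end, so
  \<open>down_out\<close> loses no information.\<close>

lemma card_USO_le: "card {s. is_USO n s} \<le> (n + 1) ^ (2 ^ n)"
proof -
  have "inj_on (down_out (cube n)) {s. is_USO n s}"
  proof (rule inj_onI)
    fix s s' assume "s \<in> {s. is_USO n s}" "s' \<in> {s. is_USO n s}"
      and eq: "down_out (cube n) s = down_out (cube n) s'"
    then have ori: "orientation n s" "orientation n s'" by (auto simp: is_USO_def)
    have same: "s w \<inter> w = s' w \<inter> w" if "w \<in> cube n" for w
      using fun_cong[OF eq, of w] that by (simp add: down_out_def)
    have "j \<in> s v \<longleftrightarrow> j \<in> s' v" if v: "v \<in> cube n" and j: "j < n" for v j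
    proof (cases "j \<in> v")
      case True
      then show ?thesis using same[OF v] by blast
    next
      case False
      have c: "insert j v \<in> cube n" using v j by (auto simp: cube_def)
      show ?thesis
        using same[OF c] orientation_insert_iff[OF ori(1) c False]
          orientation_insert_iff[OF ori(2) c False] by blast
    qed
    moreover have "s v \<subseteq> {0..<n}" "s' v \<subseteq> {0..<n}" if "v \<in> cube n" for v
      using ori that by (auto simp: orientation_def)
    moreover have "s v = {}" "s' v = {}" if "v \<notin> cube n" for v
      using ori that by (auto simp: orientation_def)
    ultimately show "s = s'" by (metis (no_types, lifting) atLeastLessThan_iff ext set_eqI subset_iff)
  qed
  then have "card {s. is_USO n s} = card (down_out (cube n) ` {s. is_USO n s})"
    by (simp add: card_image)
  also have "\<dots> \<le> (n + 1) ^ card (cube n)"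
    by (rule card_down_out_le) (auto simp: cube_def)
  finally show ?thesis by (simp add: cube_def card_Pow)
qed

section \<open>Counting matchings\<close>

definition matchings :: "'a set set \<Rightarrow> nat \<Rightarrow> 'a set set set" where
  "matchings E k = {M. M \<subseteq> E \<and> card M = k \<and> pairwise disjnt M}"

lemma finite_matchings: "finite E \<Longrightarrow> finite (matchings E k)"
  by (rule finite_subset[of _ "Pow E"]) (auto simp: matchings_def)

lemma matchings_0: "finite E \<Longrightarrow> matchings E 0 = {{}}"
  using finite_subset by (fastforce simp: matchings_def)

text \<open>Double counting of the pairs of a matching of size \<open>k + 1\<close> and one of its edges.\<close>

lemma card_matchings_Suc:
  fixes E :: "'a set set"
  assumes fin: "finite E" and ne: "{} \<notin> E"
    and deg: "\<And>e. e \<in> E \<Longrightarrow> card {e' \<in> E. \<not> disjnt e e'} \<le> D"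
  shows "card (matchings E k) * (card E - k * D) \<le> Suc k * card (matchings E (Suc k))"
proof -
  let ?free = "\<lambda>M. {e \<in> E. \<forall>e'\<in>M. disjnt e' e}"
  let ?A = "SIGMA M : matchings E k. ?free M"
  let ?B = "SIGMA M : matchings E (Suc k). M"
  have finM: "finite M" if "M \<in> matchings E k" for M k
    using that fin finite_subset by (auto simp: matchings_def)
  \<comment> \<open>Each of the \<open>k\<close> edges of \<open>M\<close> blocks at most
    \<open>D\<close> edges, itself included.\<close>
  have free: "card E - k * D \<le> card (?free M)" if M: "M \<in> matchings E k" for M
  proof -
    have "E - ?free M \<subseteq> (\<Union>e'\<in>M. {e \<in> E. \<not> disjnt e' e})" by auto
    then have "card (E - ?free M) \<le> card (\<Union>e'\<in>M. {e \<in> E. \<not> disjnt e' e})"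
      using fin finM[OF M] by (intro card_mono) auto
    also have "\<dots> \<le> (\<Sum>e'\<in>M. card {e \<in> E. \<not> disjnt e' e})"
      using finM[OF M] by (rule card_UN_le)
    also have "\<dots> \<le> (\<Sum>e'\<in>M. D)"
      using M by (intro sum_mono deg) (auto simp: matchings_def)
    also have "\<dots> = k * D" using M by (simp add: matchings_def)
    finally have "card (E - ?free M) \<le> k * D" .
    moreover have "card (E - ?free M) = card E - card (?free M)"
      using fin by (intro card_Diff_subset) auto
    ultimately show ?thesis by linarith
  qed
  \<comment> \<open>A nonempty edge is not disjoint from itself, so adding a free edge really
    increases the size of the matching.\<close>
  have notin: "e \<notin> M" if "e \<in> ?free M" for e M
    using that ne by (auto simp: disjnt_def)
  have "card (matchings E k) * (card E - k * D) = (\<Sum>M\<in>matchings E k. card E - k * D)" by simp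
  also have "\<dots> \<le> (\<Sum>M\<in>matchings E k. card (?free M))" by (intro sum_mono free)
  also have "\<dots> = card ?A"
    using fin by (subst card_SigmaI) (auto simp: finite_matchings)
  also have "\<dots> \<le> card ?B"
  proof (rule card_inj_on_le)
    show "inj_on (\<lambda>(M, e). (insert e M, e)) ?A"
    proof (rule inj_onI)
      fix p q assume pq: "p \<in> ?A" "q \<in> ?A" "(\<lambda>(M, e). (insert e M, e)) p = (\<lambda>(M, e). (insert e M, e)) q"
      obtain M M' e where p: "p = (M, e)" "q = (M', e)" and eq: "insert e M = insert e M'"
        using pq(3) by (cases p; cases q) auto
      have "e \<notin> M" "e \<notin> M'" using pq(1,2) notin unfolding p by blast+
      then show "p = q" using eq p by (simp add: insert_ident)
    qed
    show "(\<lambda>(M, e). (insert e M, e)) ` ?A \<subseteq> ?B"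
    proof (rule image_subsetI)
      fix p assume "p \<in> ?A"
      then obtain M e where p: "p = (M, e)" and M: "M \<in> matchings E k"
        and e: "e \<in> E" "\<forall>e'\<in>M. disjnt e' e" by blast
      have "e \<notin> M" using notin[of e M] e by blast
      moreover have "pairwise disjnt (insert e M)"
        using M e by (auto simp: matchings_def pairwise_insert disjnt_sym)
      ultimately have "insert e M \<in> matchings E (Suc k)"
        using M e finM[OF M] by (simp add: matchings_def)
      then show "(\<lambda>(M, e). (insert e M, e)) p \<in> ?B" by (simp add: p)
    qed
    show "finite ?B" using finM by (intro finite_SigmaI finite_matchings[OF fin])
  qed
  also have "\<dots> = (\<Sum>M\<in>matchings E (Suc k). card M)"
    using fin finM by (subst card_SigmaI) (auto simp: finite_matchings)
  also have "\<dots> = Suc k * card (matchings E (Suc k))"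
    by (simp add: matchings_def)
  finally show ?thesis .
qed

text \<open>As long as fewer than \<open>T\<close> edges are chosen, at least \<open>T * b\<close>
  edges remain free. Iterating gives \<open>(T * b) ^ T\<close> ordered choices, and dividing by the
  \<open>fact T \<le> T ^ T\<close> orders leaves \<open>b ^ T\<close>.\<close>

lemma card_matchings_ge:
  fixes E :: "'a set set"
  assumes "finite E" and "{} \<notin> E"
    and "\<And>e. e \<in> E \<Longrightarrow> card {e' \<in> E. \<not> disjnt e e'} \<le> D"
    and T: "T * (D + b) \<le> card E"
  shows "b ^ T \<le> card (matchings E T)"
proof (cases "T = 0")
  case True
  then show ?thesis using matchings_0[OF assms(1)] by simp
next
  case False
  have "(T * b) ^ k \<le> fact k * card (matchings E k)" if "k \<le> T" for k
    using that
  proof (induction k)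
    case 0
    show ?case using matchings_0[OF assms(1)] by simp
  next
    case (Suc k)
    have "k * D \<le> T * D" using Suc.prems by (intro mult_right_mono) auto
    then have "T * b \<le> card E - k * D" using T unfolding distrib_left by linarith
    then have "(T * b) ^ Suc k \<le> (card E - k * D) * (fact k * card (matchings E k))"
      unfolding power_Suc using Suc by (intro mult_mono) auto
    also have "\<dots> = fact k * (card (matchings E k) * (card E - k * D))" by simp
    also have "\<dots> \<le> fact k * (Suc k * card (matchings E (Suc k)))"
      by (intro mult_left_mono card_matchings_Suc assms(1-3)) auto
    finally show ?case by (simp add: algebra_simps)
  qed
  from this[of T] have "(T * b) ^ T \<le> fact T * card (matchings E T)" by simp
  also have "\<dots> \<le> T ^ T * card (matchings E T)"
    using fact_le_power[of T, where ?'a = nat] by (intro mult_right_mono) auto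
  finally have "T ^ T * b ^ T \<le> T ^ T * card (matchings E T)" by (simp add: power_mult_distrib)
  then show ?thesis using False by simp
qed

section \<open>Flipping a matching in the uniform orientation\<close>

text \<open>An edge is the set of its two ends, so that a matching is a pairwise disjoint family and
  the two ends give the same edge.\<close>

definition cube_edge :: "nat set \<Rightarrow> nat \<Rightarrow> nat set set" where
  "cube_edge v j = {v, symd v {j}}"

lemma symd_symd [simp]: "symd (symd v A) A = v"
  by (auto simp: symd_def)

lemma symd_left_cancel [simp]: "symd v A = symd v B \<longleftrightarrow> A = B"
  by (auto simp: symd_def)

lemma symd_singleton_neq [simp]: "symd v {j} \<noteq> v" "v \<noteq> symd v {j}"
  by (auto simp: symd_def)

lemma cube_edge_symd: "cube_edge (symd v {j}) j = cube_edge v j"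
  by (auto simp: cube_edge_def)

lemma cube_edge_eq_iff: "cube_edge v i = cube_edge v j \<longleftrightarrow> i = j"
  by (auto simp: cube_edge_def doubleton_eq_iff)

section \<open>Edges of the upper facet and their number\<close>

definition upper_edges :: "nat \<Rightarrow> nat set set set" where
  "upper_edges m = {cube_edge v j | v j. v \<in> cube (Suc m) \<and> m \<in> v \<and> j < m}"

text \<open>For a matching this set has at most one element; as a set it can be added to an outmap
  by \<open>symd\<close>.\<close>

definition mates :: "nat set set set \<Rightarrow> nat set \<Rightarrow> nat set" where
  "mates M v = {j. cube_edge v j \<in> M}"

text \<open>The outmap of the uniform orientation is the identity, and flipping an edge toggles its
  direction in the outmap at both ends. The value outside the cube is the one that
  \<open>orientation\<close> demands.\<close>

definition flipped :: "nat \<Rightarrow> nat set set set \<Rightarrow> nat set \<Rightarrow> nat set" where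
  "flipped n M v = (if v \<in> cube n then symd v (mates M v) else {})"

text \<open>An edge determines its direction and has one name per end. As the direction is below
  \<open>m\<close>, moving along it preserves membership of \<open>m\<close>.\<close>

lemma cube_edge_in_upper_edges:
  assumes "cube_edge v j \<in> upper_edges m"
  shows "v \<in> cube (Suc m)" "m \<in> v" "j < m"
proof -
  obtain u i where u: "cube_edge v j = cube_edge u i" "u \<in> cube (Suc m)" "m \<in> u" "i < m"
    using assms by (auto simp: upper_edges_def)
  have "j = i \<and> (v = u \<or> v = symd u {i})"
  proof (cases "v = u")
    case True
    then show ?thesis using u(1) by (simp add: cube_edge_eq_iff)
  next
    case False
    then have "v = symd u {i}" "u = symd v {j}"
      using u(1) by (auto simp: cube_edge_def doubleton_eq_iff)
    then show ?thesis by (metis singleton_inject symd_left_cancel symd_symd)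
  qed
  then show "v \<in> cube (Suc m)" "m \<in> v" "j < m"
    using u by (auto simp: symd_def cube_def)
qed

lemma finite_upper_edges: "finite (upper_edges m)"
proof -
  have "upper_edges m \<subseteq> (\<lambda>(v, j). cube_edge v j) ` (cube (Suc m) \<times> {..<m})"
    by (force simp: upper_edges_def)
  then show ?thesis by (rule finite_subset) (simp add: finite_cube)
qed

text \<open>The pair \<open>(j, y)\<close> encodes the edge by its direction and its lower end
  \<open>insert m y\<close>; there are \<open>m\<close> directions with \<open>2 ^ (m - 1)\<close>
  lower ends each.\<close>

lemma card_upper_edges: "m * 2 ^ (m - 1) \<le> card (upper_edges m)"
proof -
  let ?S = "SIGMA j : {..<m}. Pow ({..<m} - {j})"
  let ?f = "\<lambda>(j, y). cube_edge (insert m y) j"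
  have "card ?S = (\<Sum>j<m. 2 ^ (m - 1))"
    by (subst card_SigmaI) (auto simp: card_Pow)
  then have "m * 2 ^ (m - 1) = card ?S" by simp
  also have "\<dots> \<le> card (upper_edges m)"
  proof (rule card_inj_on_le)
    show "inj_on ?f ?S"
    proof (rule inj_onI)
      fix p q assume pq: "p \<in> ?S" "q \<in> ?S" "?f p = ?f q"
      obtain i y j z where p: "p = (i, y)" "q = (j, z)" by (cases p; cases q)
      have iy: "i < m" "y \<subseteq> {..<m} - {i}" and jz: "j < m" "z \<subseteq> {..<m} - {j}"
        and eq: "cube_edge (insert m y) i = cube_edge (insert m z) j"
        using pq by (simp_all add: p Pow_iff)
      have s: "symd (insert m y) {i} = insert i (insert m y)" "symd (insert m z) {j} = insert j (insert m z)"
        using iy jz by (auto simp: symd_def)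
      have "insert m y = insert m z"
      proof (rule ccontr)
        \<comment> \<open>Then the lower end of each edge would be the upper end of the
          other.\<close>
        assume "insert m y \<noteq> insert m z"
        then have "insert m y = insert j (insert m z)" "insert i (insert m y) = insert m z"
          using eq by (auto simp: cube_edge_def s doubleton_eq_iff)
        then have "i \<in> insert m z" "insert m z \<subseteq> insert m y \<or> i \<notin> z" by blast+
        then show False using iy by auto
      qed
      moreover from this have "i = j" using eq cube_edge_eq_iff by simp
      moreover have "m \<notin> y" "m \<notin> z" using iy jz by auto
      ultimately show "p = q" by (simp add: p insert_ident)
    qed
    show "?f ` ?S \<subseteq> upper_edges m"
      by (fastforce simp: upper_edges_def cube_def)
  qed (rule finite_upper_edges)
  finally show ?thesis .
qed

text \<open>An edge meeting \<open>e\<close> contains one of its two ends and is determined by that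
  end and one of \<open>m\<close> directions.\<close>

lemma card_upper_edges_meeting:
  assumes "e \<in> upper_edges m"
  shows "card {e' \<in> upper_edges m. \<not> disjnt e e'} \<le> 2 * m"
proof -
  obtain v j where e: "e = cube_edge v j" using assms by (auto simp: upper_edges_def)
  let ?f = "\<lambda>(u, j). cube_edge u j"
  have "{e' \<in> upper_edges m. \<not> disjnt e e'} \<subseteq> ?f ` (e \<times> {..<m})"
  proof (rule subsetI)
    fix e' assume "e' \<in> {e' \<in> upper_edges m. \<not> disjnt e e'}"
    then have e': "e' \<in> upper_edges m" "\<not> disjnt e e'" by simp_all
    then obtain v i where i: "e' = cube_edge v i" "i < m" by (auto simp: upper_edges_def)
    obtain u where u: "u \<in> e" "u \<in> e'" using e' by (auto simp: disjnt_def)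
    then have "e' = cube_edge u i" using i cube_edge_symd by (auto simp: cube_edge_def)
    then show "e' \<in> ?f ` (e \<times> {..<m})" using u i by auto
  qed
  moreover have fin: "finite (e \<times> {..<m})" by (simp add: e cube_edge_def)
  ultimately have "card {e' \<in> upper_edges m. \<not> disjnt e e'} \<le> card (e \<times> {..<m})"
    by (metis (no_types, lifting) card_image_le card_mono finite_imageI order_trans)
  also have "\<dots> = 2 * m" by (simp add: e cube_edge_def card_cartesian_product)
  finally show ?thesis .
qed

section \<open>Orientations obtained by flipping a matching\<close>

context
  fixes m :: nat and M :: "nat set set set"
  assumes M: "M \<subseteq> upper_edges m" "pairwise disjnt M"
begin

text \<open>Two edges of \<open>M\<close> at \<open>v\<close> share the vertex \<open>v\<close>, so
  they coincide and have the same direction.\<close>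

lemma mates_props:
  assumes "j \<in> mates M v"
  shows "mates M v = {j}" "j \<in> mates M (symd v {j})" "m \<in> v" "j < m"
proof -
  have e: "cube_edge v j \<in> M" using assms by (simp add: mates_def)
  have "i = j" if "i \<in> mates M v" for i
  proof -
    have "\<not> disjnt (cube_edge v i) (cube_edge v j)" by (auto simp: cube_edge_def disjnt_def)
    then have "cube_edge v i = cube_edge v j"
      using that e M(2) by (auto simp: mates_def pairwise_def)
    then show ?thesis by (simp add: cube_edge_eq_iff)
  qed
  then show "mates M v = {j}" using assms by blast
  show "j \<in> mates M (symd v {j})" using e by (simp add: mates_def cube_edge_symd)
  show "m \<in> v" "j < m" using e M(1) cube_edge_in_upper_edges by blast+
qed

text \<open>With \<open>b\<close> the bottom vertex of a face in directions \<open>J\<close>, the sink is \<open>b\<close> or, if the edge at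
  \<open>b\<close> in a direction \<open>j\<close> of the face was flipped, its neighbour across that edge.\<close>

lemma is_USO_flipped: "is_USO (Suc m) (flipped (Suc m) M)"
  unfolding is_USO_def
proof (intro conjI allI impI ballI)
  let ?n = "Suc m"
  show "orientation ?n (flipped ?n M)"
    unfolding orientation_def
  proof (intro conjI allI impI ballI)
    fix v assume v: "v \<in> cube ?n"
    show "flipped ?n M v \<subseteq> {0..<?n}"
      using v mates_props(4)[of _ v] by (auto simp: flipped_def symd_def cube_def) (meson less_SucI)
    fix j assume j: "j < ?n"
    have c: "symd v {j} \<in> cube ?n" using v j by (auto simp: cube_def symd_def)
    \<comment> \<open>The toggle of \<open>j\<close> happens at both ends of an edge or at neither,
      so the ends still disagree on \<open>j\<close>.\<close>
    have "j \<in> mates M v \<longleftrightarrow> j \<in> mates M (symd v {j})"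
      using mates_props(2)[of j v] mates_props(2)[of j "symd v {j}"] by auto
    then show "j \<in> flipped ?n M v \<longleftrightarrow> j \<notin> flipped ?n M (symd v {j})"
      using v c by (auto simp: flipped_def symd_def)
  qed (simp add: flipped_def)
  fix J v assume J: "J \<subseteq> {0..<?n}" and v: "v \<in> cube ?n"
  define b where "b = v - J"
  have sink: "u \<in> face ?n J v \<and> flipped ?n M u \<inter> J = {} \<longleftrightarrow>
      u - J = b \<and> u \<inter> J = mates M u \<inter> J" for u
    using v J by (auto simp: face_def b_def flipped_def symd_def cube_def)
  \<comment> \<open>A sink \<open>u\<close> above the bottom in direction \<open>j\<close> is
    matched in direction \<open>j\<close> and no other, so \<open>u\<close> is the neighbour of
    \<open>b\<close> across a flipped edge.\<close>
  have up: "j \<in> mates M b" if "u - J = b" "u \<inter> J = mates M u \<inter> J" "j \<in> u" "j \<in> J" for u j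
  proof -
    have "j \<in> mates M u" using that by blast
    then have "mates M u = {j}" "j \<in> mates M (symd u {j})" using mates_props by blast+
    moreover have "symd u {j} = b" using that calculation by (auto simp: symd_def)
    ultimately show ?thesis by simp
  qed
  have bJ: "b - J = b" "b \<inter> J = {}" by (auto simp: b_def)
  show "\<exists>!u. u \<in> face ?n J v \<and> flipped ?n M u \<inter> J = {}"
    unfolding sink
  proof (cases "mates M b \<inter> J = {}")
    case True
    show "\<exists>!u. u - J = b \<and> u \<inter> J = mates M u \<inter> J"
    proof (rule ex1I[of _ b])
      show "b - J = b \<and> b \<inter> J = mates M b \<inter> J" using True bJ by simp
      fix u assume u: "u - J = b \<and> u \<inter> J = mates M u \<inter> J"
      then have "u \<inter> J = {}" using up[of u] True by blast
      then show "u = b" using u by blast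
    qed
  next
    case False
    then obtain j where j: "j \<in> mates M b" "j \<in> J" by blast
    have mb: "mates M b = {j}" "j \<in> mates M (symd b {j})" using mates_props j by blast+
    moreover have sb: "symd b {j} = insert j b" using j bJ by (auto simp: symd_def)
    ultimately have mj: "mates M (insert j b) = {j}" using mates_props(1) by metis
    show "\<exists>!u. u - J = b \<and> u \<inter> J = mates M u \<inter> J"
    proof (rule ex1I[of _ "insert j b"])
      show "insert j b - J = b \<and> insert j b \<inter> J = mates M (insert j b) \<inter> J"
        using mj j bJ by auto
      fix u assume u: "u - J = b \<and> u \<inter> J = mates M u \<inter> J"
      then have "u \<inter> J \<subseteq> {j}" using up[of u] mb by blast
      moreover have "u \<inter> J \<noteq> {}"
      proof
        assume "u \<inter> J = {}"
        then have "u = b" using u by blast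
        then show False using u j bJ by blast
      qed
      ultimately have "u \<inter> J = {j}" by blast
      then show "u = insert j b" using u by blast
    qed
  qed
qed

lemma flipped_lower:
  assumes "v \<in> cube (Suc m)" "m \<notin> v"
  shows "flipped (Suc m) M v = v"
  using assms mates_props(3)[of _ v] by (auto simp: flipped_def symd_def)

text \<open>In the lower facet every arc deletes an element, so a path from there never leaves the
  facet.\<close>

lemma reachable_lower:
  assumes "(u, w) \<in> (arcs (Suc m) (flipped (Suc m) M))\<^sup>*" "u \<in> cube (Suc m)" "m \<notin> u"
  shows "w \<subseteq> u"
  using assms(1)
proof (induction rule: rtrancl_induct)
  case (step w x)
  have w: "w \<in> cube (Suc m)" "m \<notin> w" using step.IH assms(2,3) by (auto simp: cube_def)
  then obtain j where "x = symd w {j}" "j \<in> w"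
    using step.hyps(2) flipped_lower[OF w] by (auto simp: arcs_def)
  then show ?case using step.IH by (auto simp: symd_def)
qed simp

lemma reachmap_lower:
  assumes u: "u \<in> cube (Suc m)" "m \<notin> u"
  shows "reachmap (Suc m) (flipped (Suc m) M) u \<subseteq> u"
proof -
  have "j \<in> u" if "(u, w) \<in> (arcs (Suc m) (flipped (Suc m) M))\<^sup>*" "j \<in> flipped (Suc m) M w" for w j
  proof -
    have "w \<subseteq> u" using reachable_lower[OF that(1) u] .
    moreover from this have "flipped (Suc m) M w = w" using u by (intro flipped_lower) (auto simp: cube_def)
    ultimately show ?thesis using that(2) by blast
  qed
  then show ?thesis using flipped_lower[OF u] by (auto simp: reachmap_def)
qed

lemma nice_flipped: "nice (Suc m) 1 (flipped (Suc m) M)"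
  unfolding nice_def
proof (intro ballI impI)
  let ?n = "Suc m" let ?s = "flipped (Suc m) M"
  fix v assume v: "v \<in> cube ?n" and nsink: "v \<noteq> global_sink ?n ?s"
  have e: "{} \<in> cube ?n" "?s {} = {}" using flipped_lower[of "{}"] by (auto simp: cube_def)
  \<comment> \<open>The whole cube is itself a face; its unique sink is the empty set, which
    identifies \<open>global_sink\<close>.\<close>
  have "\<exists>!u. u \<in> face ?n {0..<?n} {} \<and> ?s u \<inter> {0..<?n} = {}"
    using is_USO_flipped e(1) unfolding is_USO_def by blast
  moreover have "u \<in> face ?n {0..<?n} {} \<longleftrightarrow> u \<in> cube ?n" for u
    by (auto simp: face_def symd_def cube_def)
  moreover have "?s u \<subseteq> {0..<?n}" if "u \<in> cube ?n" for u
    using is_USO_flipped that by (auto simp: is_USO_def orientation_def)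
  ultimately have "\<exists>!u. u \<in> cube ?n \<and> ?s u = {}" by (metis inf.absorb1)
  then have "global_sink ?n ?s = {}" unfolding global_sink_def using e by (intro the1_equality) auto
  with nsink have "v \<noteq> {}" by simp
  \<comment> \<open>The covering vertex is \<open>v - {j}\<close> in the lower facet. In the upper
    facet \<open>j = m\<close> works because no edge in direction \<open>m\<close> is flipped; in
    the lower facet any \<open>j\<close> in \<open>v\<close> does. Below \<open>v - {j}\<close> the
    direction \<open>j\<close> never reappears.\<close>
  have "\<exists>j\<in>v. j \<in> ?s v \<and> m \<notin> v - {j}"
  proof (cases "m \<in> v")
    case True
    then have "m \<in> ?s v" using v mates_props(4)[of m v] by (auto simp: flipped_def symd_def)
    then show ?thesis using True by blast
  next
    case False
    then show ?thesis using \<open>v \<noteq> {}\<close> flipped_lower[OF v] by blast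
  qed
  then obtain j where j: "j \<in> v" "j \<in> ?s v" "m \<notin> v - {j}" by blast
  define u where "u = v - {j}"
  have u: "u \<in> cube ?n" "m \<notin> u" "symd v {j} = u" using v j by (auto simp: u_def cube_def symd_def)
  have jn: "j < ?n" using v j by (auto simp: cube_def)
  have arc: "(v, u) \<in> arcs ?n ?s" using v j jn u(3) by (auto simp: arcs_def)
  then have "(v, u) \<in> arcs ?n ?s ^^ 1" by simp
  then have "dpath ?n ?s v u \<le> enat 1" unfolding dpath_def by (intro Inf_lower) blast
  moreover have "reachmap ?n ?s u \<subseteq> reachmap ?n ?s v"
    using arc by (auto simp: reachmap_def intro: converse_rtrancl_into_rtrancl)
  moreover have "j \<in> reachmap ?n ?s v" using j by (simp add: reachmap_def)
  moreover have "j \<notin> reachmap ?n ?s u" using reachmap_lower[OF u(1,2)] by (auto simp: u_def)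
  ultimately show "\<exists>u\<in>cube ?n. covered_by ?n ?s 1 v u"
    using u(1) unfolding covered_by_def by blast
qed

text \<open>Comparison with the uniform outmap recovers the flipped edges, so different matchings
  give different orientations.\<close>

lemma matching_of_flipped:
  "M = {cube_edge v j | v j. v \<in> cube (Suc m) \<and> j \<in> symd v (flipped (Suc m) M v)}"
proof -
  have "symd v (flipped (Suc m) M v) = mates M v" if "v \<in> cube (Suc m)" for v
    using that by (auto simp: flipped_def symd_def)
  then show ?thesis
    using M(1) by (auto simp: upper_edges_def mates_def) blast
qed

end

section \<open>The two bounds combined\<close>

lemma card_nice_USO_ge:
  assumes m: "3 \<le> m"
  shows "(2 * m) ^ (2 ^ (m - 3)) \<le> card {s. is_USO (Suc m) s \<and> nice (Suc m) 1 s}"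
proof -
  \<comment> \<open>With \<open>D = b = 2 * m\<close>, the condition
    \<open>T * (D + b) \<le> card E\<close> becomes \<open>4 * m * T \<le> m * 2 ^ (m - 1)\<close>,
    an equality for this \<open>T\<close>.\<close>
  let ?T = "2 ^ (m - 3) :: nat"
  have "(2 * m) ^ ?T \<le> card (matchings (upper_edges m) ?T)"
  proof (rule card_matchings_ge[OF finite_upper_edges _ card_upper_edges_meeting])
    show "{} \<notin> upper_edges m" by (auto simp: upper_edges_def cube_edge_def)
    have "?T * (2 * m + 2 * m) = m * 2 ^ (m - 1)"
    proof -
      obtain k where "m = k + 3" using m by (metis le_add_diff_inverse2)
      then show ?thesis by (simp add: power_add algebra_simps)
    qed
    then show "?T * (2 * m + 2 * m) \<le> card (upper_edges m)"
      using card_upper_edges[of m] by linarith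
  qed
  also have "\<dots> \<le> card {s. is_USO (Suc m) s \<and> nice (Suc m) 1 s}"
  proof (rule card_inj_on_le)
    show "inj_on (flipped (Suc m)) (matchings (upper_edges m) ?T)"
    proof (rule inj_onI)
      fix M M' assume M: "M \<in> matchings (upper_edges m) ?T" "M' \<in> matchings (upper_edges m) ?T"
        and eq: "flipped (Suc m) M = flipped (Suc m) M'"
      have rec: "M = {cube_edge v j | v j. v \<in> cube (Suc m) \<and> j \<in> symd v (flipped (Suc m) M v)}"
        if "M \<in> matchings (upper_edges m) ?T" for M
        using that by (intro matching_of_flipped) (auto simp: matchings_def)
      show "M = M'" by (rule trans[OF rec[OF M(1), unfolded eq] rec[OF M(2), symmetric]])
    qed
    show "flipped (Suc m) ` matchings (upper_edges m) ?T \<subseteq> {s. is_USO (Suc m) s \<and> nice (Suc m) 1 s}"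
      using is_USO_flipped nice_flipped by (auto simp: matchings_def)
    show "finite {s. is_USO (Suc m) s \<and> nice (Suc m) 1 s}"
      by (rule finite_subset[OF _ finite_USO]) auto
  qed
  finally show ?thesis .
qed

theorem theorem10:
  shows "\<exists>c1 c2 :: real. \<exists>N :: nat. c1 > 0 \<and> c2 > 0 \<and>
    (\<forall>n \<ge> N.
       real n powr (c1 * 2 ^ n) \<le> real (card {s. is_USO n s \<and> nice n 1 s}) \<and>
       real (card {s. is_USO n s \<and> nice n 1 s}) \<le> real n powr (c2 * 2 ^ n))"
proof (intro exI conjI allI impI)
  \<comment> \<open>Here \<open>N = 4\<close> ensures \<open>3 \<le> m\<close> for
    \<open>n = Suc m\<close>. The constant \<open>c1 = 1 / 16\<close> comes from
    \<open>2 ^ (m - 3) = 2 ^ n / 16\<close>, and \<open>c2 = 2\<close> from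
    \<open>n + 1 \<le> n\<^sup>2\<close>.\<close>
  fix n :: nat assume n: "4 \<le> n"
  let ?S = "{s. is_USO n s \<and> nice n 1 s}"
  have pow: "real n powr real k = real (n ^ k)" for k
    using n by (simp add: powr_realpow)
  obtain m where m: "n = Suc m" "3 \<le> m" using n by (cases n) auto
  have "(1 / 16 :: real) * 2 ^ n = real (2 ^ (m - 3))"
  proof -
    obtain k where "m = k + 3" using m by (metis le_add_diff_inverse2)
    then show ?thesis using m(1) by (simp add: power_add)
  qed
  then have "real n powr (1 / 16 * 2 ^ n) = real (n ^ 2 ^ (m - 3))"
    by (simp only: pow)
  also have "\<dots> \<le> real ((2 * m) ^ 2 ^ (m - 3))"
    using m by (intro of_nat_mono power_mono) auto
  also have "\<dots> \<le> real (card ?S)"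
    using card_nice_USO_ge[OF m(2)] m(1) by (intro of_nat_mono) simp
  finally show "real n powr (1 / 16 * 2 ^ n) \<le> real (card ?S)" .
  have "card ?S \<le> card {s. is_USO n s}"
    by (intro card_mono finite_USO) auto
  also have "\<dots> \<le> (n + 1) ^ 2 ^ n" by (rule card_USO_le)
  also have "\<dots> \<le> (n\<^sup>2) ^ 2 ^ n"
  proof (rule power_mono)
    have "4 * n \<le> n * n" using n by (intro mult_right_mono) auto
    then show "n + 1 \<le> n\<^sup>2" using n unfolding power2_eq_square by linarith
  qed simp
  also have "\<dots> = n ^ (2 * 2 ^ n)" by (simp add: power_mult)
  finally have "real (card ?S) \<le> real (n ^ (2 * 2 ^ n))" by (rule of_nat_mono)
  also have "\<dots> = real n powr real (2 * 2 ^ n)"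
    by (simp only: pow)
  also have "real (2 * 2 ^ n) = 2 * 2 ^ n" by simp
  finally show "real (card ?S) \<le> real n powr (2 * 2 ^ n)" .
qed simp_all

end
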